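(* Let $L$ be one of Choi's two Latin squares of order $9$ (displayed in the context as $L_1$ and $L_2$). Then the maximum number of mutually orthogonal Latin squares in $D_8(L)$ is exactly two.
   Context: A Latin square of order $n$ is an $n\times n$ array with entries in $\{1,\dots,n\}$ in which each symbol occurs exactly once in each row and each column. Two Latin squares $(a_{ij})$, $(b_{ij})$ of order $n$ are orthogonal if the $n^2$ ordered pairs $(a_{ij},b_{ij})$ are all distinct. A set of Latin squares is mutually orthogonal if any two distinct members are orthogonal. Choi's two Latin squares of order 9 are $$L_1=\begin{pmatrix}5&6&4&8&9&7&2&3&1\\4&5&6&7&8&9&1&2&3\\6&4&5&9&7&8&3&1&2\\2&3&1&5&6&4&8&9&7\\1&2&3&4&5&6&7&8&9\\3&1&2&6&4&5&9&7&8\\8&9&7&2&3&1&5&6&4\\7&8&9&1&2&3&4&5&6\\9&7&8&3&1&2&6&4&5\end{pmatrix},\qquad L_2=\begin{pmatrix}1&3&2&7&9&8&4&6&5\\3&2&1&9&8&7&6&5&4\\2&1&3&8&7&9&5&4&6\\7&9&8&4&6&5&1&3&2\\9&8&7&6&5&4&3&2&1\\8&7&9&5&4&6&2&1&3\\4&6&5&1&3&2&7&9&8\\6&5&4&3&2&1&9&8&7\\5&4&6&2&1&3&8&7&9\end{pmatrix}.$$ For a Latin square $A=(a_{ij})$ of order $n$, define (the displayed expression is the $(i,j)$ entry): $r_0(A)=(a_{ij})$, $r_1(A)=(a_{j(n+1-i)})$, $r_2(A)=(a_{(n+1-i)(n+1-j)})$, $r_3(A)=(a_{(n+1-j)i})$,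 $s_0(A)=(a_{(n+1-i)j})$, $s_1(A)=(a_{ji})$, $s_2(A)=(a_{i(n+1-j)})$, $s_3(A)=(a_{(n+1-j)(n+1-i)})$, and $D_8(A)=\{A,r_1(A),r_2(A),r_3(A),s_0(A),s_1(A),s_2(A),s_3(A)\}$. "The maximum number of mutually orthogonal Latin squares in $D_8(A)$" is the largest size of a mutually orthogonal subset of $D_8(A)$. *)

theory Defs
  imports "Jordan_Normal_Form.Matrix"
begin

text \<open>
  An \<open>n \<times> n\<close> array is a matrix over \<^typ>\<open>nat\<close>, so that equality of arrays only concerns
  the \<open>n\<^sup>2\<close> entries. Positions are counted from \<open>0\<close>, symbols from \<open>1\<close>: the usual index
  \<open>n + 1 - i\<close> of the reversed row or column becomes \<open>n - 1 - i\<close>.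
\<close>

definition latin_square :: "nat \<Rightarrow> nat mat \<Rightarrow> bool" where
  "latin_square n A \<longleftrightarrow>
     A \<in> carrier_mat n n \<and>
     (\<forall>i<n. \<forall>j<n. A $$ (i, j) \<in> {1..n}) \<and>
     (\<forall>i<n. \<forall>s\<in>{1..n}. \<exists>!j. j < n \<and> A $$ (i, j) = s) \<and>
     (\<forall>j<n. \<forall>s\<in>{1..n}. \<exists>!i. i < n \<and> A $$ (i, j) = s)"

definition orthogonal :: "nat \<Rightarrow> nat mat \<Rightarrow> nat mat \<Rightarrow> bool" where
  "orthogonal n A B \<longleftrightarrow>
     inj_on (\<lambda>(i, j). (A $$ (i, j), B $$ (i, j))) ({..<n} \<times> {..<n})"

definition mutually_orthogonal :: "nat \<Rightarrow> nat mat set \<Rightarrow> bool" where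
  "mutually_orthogonal n S \<longleftrightarrow>
     (\<forall>A\<in>S. latin_square n A) \<and> pairwise (orthogonal n) S"

definition r1 :: "nat mat \<Rightarrow> nat mat" where
  "r1 A = (let n = dim_row A in mat n n (\<lambda>(i, j). A $$ (j, n - 1 - i)))"

definition r2 :: "nat mat \<Rightarrow> nat mat" where
  "r2 A = (let n = dim_row A in mat n n (\<lambda>(i, j). A $$ (n - 1 - i, n - 1 - j)))"

definition r3 :: "nat mat \<Rightarrow> nat mat" where
  "r3 A = (let n = dim_row A in mat n n (\<lambda>(i, j). A $$ (n - 1 - j, i)))"

definition s0 :: "nat mat \<Rightarrow> nat mat" where
  "s0 A = (let n = dim_row A in mat n n (\<lambda>(i, j). A $$ (n - 1 - i, j)))"

definition s1 :: "nat mat \<Rightarrow> nat mat" where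
  "s1 A = (let n = dim_row A in mat n n (\<lambda>(i, j). A $$ (j, i)))"

definition s2 :: "nat mat \<Rightarrow> nat mat" where
  "s2 A = (let n = dim_row A in mat n n (\<lambda>(i, j). A $$ (i, n - 1 - j)))"

definition s3 :: "nat mat \<Rightarrow> nat mat" where
  "s3 A = (let n = dim_row A in mat n n (\<lambda>(i, j). A $$ (n - 1 - j, n - 1 - i)))"

definition D8 :: "nat mat \<Rightarrow> nat mat set" where
  "D8 A = {A, r1 A, r2 A, r3 A, s0 A, s1 A, s2 A, s3 A}"

text \<open>Only meaningful for finite \<open>X\<close>, such as \<open>D8 A\<close>.\<close>

definition max_mutually_orthogonal :: "nat \<Rightarrow> nat mat set \<Rightarrow> nat" where
  "max_mutually_orthogonal n X = Max {card S | S. S \<subseteq> X \<and> mutually_orthogonal n S}"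

definition choi_L1 :: "nat mat" where
  "choi_L1 = mat_of_rows_list 9
    [[5, 6, 4, 8, 9, 7, 2, 3, 1],
     [4, 5, 6, 7, 8, 9, 1, 2, 3],
     [6, 4, 5, 9, 7, 8, 3, 1, 2],
     [2, 3, 1, 5, 6, 4, 8, 9, 7],
     [1, 2, 3, 4, 5, 6, 7, 8, 9],
     [3, 1, 2, 6, 4, 5, 9, 7, 8],
     [8, 9, 7, 2, 3, 1, 5, 6, 4],
     [7, 8, 9, 1, 2, 3, 4, 5, 6],
     [9, 7, 8, 3, 1, 2, 6, 4, 5]]"

definition choi_L2 :: "nat mat" where
  "choi_L2 = mat_of_rows_list 9
    [[1, 3, 2, 7, 9, 8, 4, 6, 5],
     [3, 2, 1, 9, 8, 7, 6, 5, 4],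
     [2, 1, 3, 8, 7, 9, 5, 4, 6],
     [7, 9, 8, 4, 6, 5, 1, 3, 2],
     [9, 8, 7, 6, 5, 4, 3, 2, 1],
     [8, 7, 9, 5, 4, 6, 2, 1, 3],
     [4, 6, 5, 1, 3, 2, 7, 9, 8],
     [6, 5, 4, 3, 2, 1, 9, 8, 7],
     [5, 4, 6, 2, 1, 3, 8, 7, 9]]"

end

theory Submission
  imports Defs
begin

text \<open>
  \<open>choi_L1\<close> is symmetric about the antidiagonal and \<open>choi_L2\<close> about the main diagonal.
  Under either symmetry of \<open>A\<close>, \<open>D8 A\<close> collapses to \<open>{A, r2 A, s0 A, s2 A}\<close>, and both
  \<open>{A, r2 A}\<close> and \<open>{s0 A, s2 A}\<close> consist of arrays sharing a diagonal symmetry. Two arrays with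
  a common symmetry repeat a pair of symbols at two mirrored cells, so they are not orthogonal. A
  mutually orthogonal set thus has at most one member in each of the two sets. Conversely, \<open>A\<close> and
  \<open>s0 A\<close> are orthogonal by inspection.
\<close>

section \<open>Dihedral images of a square array\<close>

lemma dihedral_carrier:
  assumes "A \<in> carrier_mat n n"
  shows "r1 A \<in> carrier_mat n n" "r2 A \<in> carrier_mat n n" "r3 A \<in> carrier_mat n n"
    "s0 A \<in> carrier_mat n n" "s1 A \<in> carrier_mat n n" "s2 A \<in> carrier_mat n n"
    "s3 A \<in> carrier_mat n n"
  using assms by (auto simp: r1_def r2_def r3_def s0_def s1_def s2_def s3_def Let_def)

lemma dihedral_index:
  assumes "A \<in> carrier_mat n n" "i < n" "j < n"
  shows "r1 A $$ (i, j) = A $$ (j, n - 1 - i)"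
    "r2 A $$ (i, j) = A $$ (n - 1 - i, n - 1 - j)"
    "r3 A $$ (i, j) = A $$ (n - 1 - j, i)"
    "s0 A $$ (i, j) = A $$ (n - 1 - i, j)"
    "s1 A $$ (i, j) = A $$ (j, i)"
    "s2 A $$ (i, j) = A $$ (i, n - 1 - j)"
    "s3 A $$ (i, j) = A $$ (n - 1 - j, n - 1 - i)"
  using assms by (auto simp: r1_def r2_def r3_def s0_def s1_def s2_def s3_def Let_def)

lemma s1_fixed_iff:
  assumes "A \<in> carrier_mat n n"
  shows "s1 A = A \<longleftrightarrow> (\<forall>i<n. \<forall>j<n. A $$ (j, i) = A $$ (i, j))"
proof
  assume "s1 A = A"
  then show "\<forall>i<n. \<forall>j<n. A $$ (j, i) = A $$ (i, j)"
    using dihedral_index(5)[OF assms] by metis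
next
  assume "\<forall>i<n. \<forall>j<n. A $$ (j, i) = A $$ (i, j)"
  then show "s1 A = A"
    using assms dihedral_carrier(5)[OF assms] by (auto intro!: eq_matI simp: dihedral_index)
qed

lemma s3_fixed_iff:
  assumes "A \<in> carrier_mat n n"
  shows "s3 A = A \<longleftrightarrow> (\<forall>i<n. \<forall>j<n. A $$ (n - 1 - j, n - 1 - i) = A $$ (i, j))"
proof
  assume "s3 A = A"
  then show "\<forall>i<n. \<forall>j<n. A $$ (n - 1 - j, n - 1 - i) = A $$ (i, j)"
    using dihedral_index(7)[OF assms] by metis
next
  assume "\<forall>i<n. \<forall>j<n. A $$ (n - 1 - j, n - 1 - i) = A $$ (i, j)"
  then show "s3 A = A"
    using assms dihedral_carrier(7)[OF assms] by (auto intro!: eq_matI simp: dihedral_index)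
qed

text \<open>Transposition fixes \<open>A\<close>, so precomposing with it identifies the eight
  images in pairs. The half turn preserves each diagonal while \<open>s0\<close> and
  \<open>s2\<close> exchange the two; the symmetry therefore survives in \<open>r2 A\<close> and
  turns into antidiagonal symmetry in \<open>s0 A\<close> and \<open>s2 A\<close>.\<close>

lemma D8_if_s1_fixed:
  assumes A: "A \<in> carrier_mat n n" and "s1 A = A"
  shows "D8 A = {A, r2 A, s0 A, s2 A}"
    "s1 (r2 A) = r2 A" "s3 (s0 A) = s0 A" "s3 (s2 A) = s2 A"
proof -
  note sym = assms(2)[unfolded s1_fixed_iff[OF A], rule_format]
  note carr = dihedral_carrier[OF A]
  have "r1 A = s0 A" "r3 A = s2 A" "s3 A = r2 A"
    using carr sym by (auto intro!: eq_matI simp: dihedral_index[OF A])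
  then show "D8 A = {A, r2 A, s0 A, s2 A}"
    using assms(2) by (auto simp: D8_def)
  show "s1 (r2 A) = r2 A"
    unfolding s1_fixed_iff[OF carr(2)] by (simp add: dihedral_index[OF A] sym)
  show "s3 (s0 A) = s0 A"
    unfolding s3_fixed_iff[OF carr(4)] by (simp add: dihedral_index[OF A] sym)
  show "s3 (s2 A) = s2 A"
    unfolding s3_fixed_iff[OF carr(6)] by (simp add: dihedral_index[OF A] sym)
qed

lemma D8_if_s3_fixed:
  assumes A: "A \<in> carrier_mat n n" and "s3 A = A"
  shows "D8 A = {A, r2 A, s0 A, s2 A}"
    "s3 (r2 A) = r2 A" "s1 (s0 A) = s0 A" "s1 (s2 A) = s2 A"
proof -
  note sym = assms(2)[unfolded s3_fixed_iff[OF A], rule_format]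
  note carr = dihedral_carrier[OF A]
  \<comment> \<open>The symmetry with one index reversed, as it relates \<open>r3 A\<close> to
    \<open>s0 A\<close> and, in \<open>rev'\<close>, \<open>r1 A\<close> to \<open>s2 A\<close>.
    Subtraction truncates, so \<open>n - 1 - (n - 1 - i) = i\<close> rests on
    \<open>i < n\<close>.\<close>
  have rev: "A $$ (n - 1 - i, j) = A $$ (n - 1 - j, i)" if "i < n" "j < n" for i j
    using sym[of "n - 1 - i" j] that by simp
  have rev': "A $$ (i, n - 1 - j) = A $$ (j, n - 1 - i)" if "i < n" "j < n" for i j
    using sym[of i "n - 1 - j"] that by simp
  have "r1 A = s2 A" "r3 A = s0 A" "s1 A = r2 A"
    using carr sym rev rev' by (auto intro!: eq_matI simp: dihedral_index[OF A])
  then show "D8 A = {A, r2 A, s0 A, s2 A}"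
    using assms(2) by (auto simp: D8_def)
  show "s3 (r2 A) = r2 A"
    unfolding s3_fixed_iff[OF carr(2)] using sym by (simp add: dihedral_index[OF A])
  show "s1 (s0 A) = s0 A"
    unfolding s1_fixed_iff[OF carr(4)] using rev by (simp add: dihedral_index[OF A])
  show "s1 (s2 A) = s2 A"
    unfolding s1_fixed_iff[OF carr(6)] using rev' by (simp add: dihedral_index[OF A])
qed

section \<open>Common symmetries exclude orthogonality\<close>

lemma not_orthogonalI:
  assumes "i < n" "j < n" "k < n" "l < n" "(i, j) \<noteq> (k, l)"
    and "A $$ (i, j) = A $$ (k, l)" "B $$ (i, j) = B $$ (k, l)"
  shows "\<not> orthogonal n A B"
proof
  assume "orthogonal n A B"
  from inj_onD[OF this[unfolded orthogonal_def], of "(i, j)" "(k, l)"] assms show False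
    by simp
qed

lemma not_orthogonal_if_s1_fixed:
  assumes "A \<in> carrier_mat n n" "B \<in> carrier_mat n n" "s1 A = A" "s1 B = B" "2 \<le> n"
  shows "\<not> orthogonal n A B"
proof (rule not_orthogonalI)
  show "A $$ (0, 1) = A $$ (1, 0)" "B $$ (0, 1) = B $$ (1, 0)"
    using assms by (auto simp: s1_fixed_iff)
qed (use assms(5) in auto)

lemma not_orthogonal_if_s3_fixed:
  assumes "A \<in> carrier_mat n n" "B \<in> carrier_mat n n" "s3 A = A" "s3 B = B" "2 \<le> n"
  shows "\<not> orthogonal n A B"
proof (rule not_orthogonalI)
  \<comment> \<open>These opposite corners mirror each other across the antidiagonal;
    \<open>2 \<le> n\<close> keeps them apart.\<close>
  show "A $$ (0, 0) = A $$ (n - 1, n - 1)" "B $$ (0, 0) = B $$ (n - 1, n - 1)"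
    using assms(3)[unfolded s3_fixed_iff[OF assms(1)], rule_format, of 0 0]
      assms(4)[unfolded s3_fixed_iff[OF assms(2)], rule_format, of 0 0] assms(5)
    by simp_all
qed (use assms(5) in auto)

text \<open>Pigeonhole: each of the two pairs contributes at most one element. Coinciding names do
  no harm, since a pair \<open>{a, a}\<close> has only one element anyway.\<close>

lemma card_pairwise_le_2:
  assumes "pairwise R S" "S \<subseteq> {a, b, c, d}" "\<not> R a b" "\<not> R c d"
  shows "card S \<le> 2"
proof -
  have "S \<inter> {a, b} \<subseteq> {a} \<or> S \<inter> {a, b} \<subseteq> {b}" "S \<inter> {c, d} \<subseteq> {c} \<or> S \<inter> {c, d} \<subseteq> {d}"
    using assms by (auto simp: pairwise_def)
  then obtain x y where "S \<subseteq> {x, y}"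
    using assms(2) by blast
  then have "card S \<le> card {x, y}"
    by (simp add: card_mono)
  also have "\<dots> \<le> 2"
    by (simp add: card_insert_if)
  finally show ?thesis .
qed

lemma card_mutually_orthogonal_le_2:
  assumes A: "A \<in> carrier_mat n n" and n: "2 \<le> n" and sym: "s1 A = A \<or> s3 A = A"
    and S: "S \<subseteq> D8 A" "mutually_orthogonal n S"
  shows "card S \<le> 2"
proof (rule card_pairwise_le_2)
  show "pairwise (orthogonal n) S"
    using S(2) by (simp add: mutually_orthogonal_def)
  show "S \<subseteq> {A, r2 A, s0 A, s2 A}"
    using S(1) sym D8_if_s1_fixed(1)[OF A] D8_if_s3_fixed(1)[OF A] by auto
  note carr = dihedral_carrier[OF A]
  show "\<not> orthogonal n A (r2 A)"
    using sym
  proof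
    assume "s1 A = A"
    with D8_if_s1_fixed[OF A this] show ?thesis
      by (intro not_orthogonal_if_s1_fixed) (use A n carr in auto)
  next
    assume "s3 A = A"
    with D8_if_s3_fixed[OF A this] show ?thesis
      by (intro not_orthogonal_if_s3_fixed) (use A n carr in auto)
  qed
  \<comment> \<open>Reflection has exchanged the diagonals, so each case uses the criterion for the
    opposite symmetry.\<close>
  show "\<not> orthogonal n (s0 A) (s2 A)"
    using sym
  proof
    assume "s1 A = A"
    with D8_if_s1_fixed[OF A this] show ?thesis
      by (intro not_orthogonal_if_s3_fixed) (use n carr in auto)
  next
    assume "s3 A = A"
    with D8_if_s3_fixed[OF A this] show ?thesis
      by (intro not_orthogonal_if_s1_fixed) (use n carr in auto)
  qed
qed

section \<open>Latin squares from injectivity of rows and columns\<close>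

text \<open>An injective image of \<open>n\<close> points inside an \<open>n\<close>-element set
  fills it, which gives existence; injectivity gives uniqueness.\<close>

lemma ex1_preimage:
  fixes f :: "nat \<Rightarrow> nat"
  assumes "inj_on f {..<n}" "f ` {..<n} \<subseteq> {1..n}" "s \<in> {1..n}"
  shows "\<exists>!j. j < n \<and> f j = s"
proof -
  have "f ` {..<n} = {1..n}"
    using assms by (intro card_subset_eq) (auto simp: card_image)
  then obtain j where "j < n" "f j = s"
    using assms(3) by (metis imageE lessThan_iff)
  then show ?thesis
    using inj_onD[OF assms(1)] by (metis lessThan_iff)
qed

lemma latin_squareI:
  assumes "A \<in> carrier_mat n n" "\<forall>i<n. \<forall>j<n. A $$ (i, j) \<in> {1..n}"
    and "\<forall>i<n. inj_on (\<lambda>j. A $$ (i, j)) {..<n}"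
    and "\<forall>j<n. inj_on (\<lambda>i. A $$ (i, j)) {..<n}"
  shows "latin_square n A"
  unfolding latin_square_def
proof (intro conjI allI impI ballI)
  fix i s assume "i < n" "s \<in> {1..n}"
  with assms show "\<exists>!j. j < n \<and> A $$ (i, j) = s"
    by (intro ex1_preimage) auto
next
  fix j s assume "j < n" "s \<in> {1..n}"
  with assms show "\<exists>!i. i < n \<and> A $$ (i, j) = s"
    by (intro ex1_preimage) auto
qed (use assms in auto)

lemma latin_square_col_inj:
  assumes "latin_square n A" "j < n"
  shows "inj_on (\<lambda>i. A $$ (i, j)) {..<n}"
  using assms unfolding latin_square_def inj_on_def by (metis lessThan_iff)

lemma latin_square_row_inj:
  assumes "latin_square n A" "i < n"
  shows "inj_on (\<lambda>j. A $$ (i, j)) {..<n}"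
  using assms unfolding latin_square_def inj_on_def by (metis lessThan_iff)

section \<open>Row reversal and the exact maximum\<close>

lemma latin_square_s0:
  assumes "latin_square n A"
  shows "latin_square n (s0 A)"
proof (rule latin_squareI)
  have A: "A \<in> carrier_mat n n"
    using assms by (simp add: latin_square_def)
  show "s0 A \<in> carrier_mat n n"
    by (rule dihedral_carrier[OF A])
  show "\<forall>i<n. \<forall>j<n. s0 A $$ (i, j) \<in> {1..n}"
    using assms by (simp add: dihedral_index[OF A] latin_square_def)
  show "\<forall>i<n. inj_on (\<lambda>j. s0 A $$ (i, j)) {..<n}"
    using latin_square_row_inj[OF assms, of "n - 1 - i" for i]
    by (simp add: dihedral_index[OF A] inj_on_def)
  show "\<forall>j<n. inj_on (\<lambda>i. s0 A $$ (i, j)) {..<n}"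
  proof (intro allI impI inj_onI)
    fix j k l
    assume j: "j < n" and kl: "k \<in> {..<n}" "l \<in> {..<n}" "s0 A $$ (k, j) = s0 A $$ (l, j)"
    \<comment> \<open>Column \<open>j\<close> of \<open>s0 A\<close> is column \<open>j\<close> of
      \<open>A\<close> read from bottom to top.\<close>
    then have "n - 1 - k = n - 1 - l"
      using inj_onD[OF latin_square_col_inj[OF assms j], of "n - 1 - k" "n - 1 - l"]
      by (simp add: dihedral_index[OF A])
    then show "k = l"
      using kl by auto
  qed
qed

text \<open>Ensures that \<open>{A, s0 A}\<close> has two elements: otherwise the first column of
  \<open>A\<close> would carry the same symbol at top and bottom.\<close>

lemma s0_neq_if_latin_square:
  assumes "latin_square n A" "2 \<le> n"
  shows "s0 A \<noteq> A"
proof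
  assume "s0 A = A"
  moreover have "A \<in> carrier_mat n n"
    using assms(1) by (simp add: latin_square_def)
  ultimately have "A $$ (n - 1, 0) = A $$ (0, 0)"
    using dihedral_index(4)[of A n 0 0] assms(2) by simp
  then show False
    using inj_onD[OF latin_square_col_inj[OF assms(1), of 0], of "n - 1" 0] assms(2) by simp
qed

lemma orthogonal_sym: "orthogonal n A B \<Longrightarrow> orthogonal n B A"
  by (auto simp: orthogonal_def inj_on_def)

lemma max_mutually_orthogonal_D8_eq_2:
  assumes lat: "latin_square n A" and n: "2 \<le> n" and sym: "s1 A = A \<or> s3 A = A"
    and orth: "orthogonal n A (s0 A)"
  shows "max_mutually_orthogonal n (D8 A) = 2"
  unfolding max_mutually_orthogonal_def
proof (rule Max_eqI)
  have A: "A \<in> carrier_mat n n"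
    using lat by (simp add: latin_square_def)
  \<comment> \<open>\<open>Max\<close> is meaningful only on a finite set; finitely many subsets
    give finitely many cardinalities.\<close>
  have "finite (D8 A)"
    by (simp add: D8_def)
  then show "finite {card S |S. S \<subseteq> D8 A \<and> mutually_orthogonal n S}"
    by simp
  show "m \<le> 2" if "m \<in> {card S |S. S \<subseteq> D8 A \<and> mutually_orthogonal n S}" for m
    using that card_mutually_orthogonal_le_2[OF A n sym] by auto
  have "mutually_orthogonal n {A, s0 A}"
    using lat latin_square_s0[OF lat] orth orthogonal_sym[OF orth]
    by (simp add: mutually_orthogonal_def pairwise_insert)
  moreover have "card {A, s0 A} = 2"
    using s0_neq_if_latin_square[OF lat n] by auto
  moreover have "{A, s0 A} \<subseteq> D8 A"
    by (simp add: D8_def)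
  ultimately show "2 \<in> {card S |S. S \<subseteq> D8 A \<and> mutually_orthogonal n S}"
    by (metis (mono_tags, lifting) mem_Collect_eq)
qed

section \<open>Choi's squares\<close>

text \<open>Splits entrywise claims about the concrete squares into single instances that evaluate
  on numerals.\<close>

lemma all_less_9:
  "(\<forall>i<9. P i) \<longleftrightarrow> P 0 \<and> P 1 \<and> P 2 \<and> P 3 \<and> P 4 \<and> P 5 \<and> P 6 \<and> P 7 \<and> P (8 :: nat)"
proof -
  have "{..<9 :: nat} = {0, 1, 2, 3, 4, 5, 6, 7, 8}"
    by auto
  then show ?thesis
    by (metis (no_types, lifting) insert_iff empty_iff lessThan_iff)
qed

lemma inj_on_lessThan_iff_distinct: "inj_on f {..<n :: nat} \<longleftrightarrow> distinct (map f [0..<n])"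
  by (simp add: distinct_map atLeast0LessThan)

text \<open>Executable form of orthogonality: the list runs through the cells row by row, and since
  no cell is repeated, its distinctness amounts to injectivity.\<close>

lemma orthogonal_iff_distinct:
  "orthogonal n A B \<longleftrightarrow>
     distinct (concat (map (\<lambda>i. map (\<lambda>j. (A $$ (i, j), B $$ (i, j))) [0..<n]) [0..<n]))"
proof -
  have "concat (map (\<lambda>i. map (\<lambda>j. (A $$ (i, j), B $$ (i, j))) [0..<n]) [0..<n]) =
      map (\<lambda>(i, j). (A $$ (i, j), B $$ (i, j))) (List.product [0..<n] [0..<n])"
    by (simp add: product_concat_map map_concat o_def)
  then show ?thesis
    by (simp add: orthogonal_def distinct_map distinct_product atLeast0LessThan)
qed

lemma upt_9: "[0..<9] = [0, 1, 2, 3, 4, 5, 6, 7, 8]"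
  by (simp add: upt_rec)

lemma choi_carrier: "choi_L1 \<in> carrier_mat 9 9" "choi_L2 \<in> carrier_mat 9 9"
  by (simp_all add: carrier_matI choi_L1_def choi_L2_def mat_of_rows_list_def)

lemma s3_choi_L1: "s3 choi_L1 = choi_L1"
  unfolding s3_fixed_iff[OF choi_carrier(1)] all_less_9
  by (simp add: choi_L1_def mat_of_rows_list_def)

lemma s1_choi_L2: "s1 choi_L2 = choi_L2"
  unfolding s1_fixed_iff[OF choi_carrier(2)] all_less_9
  by (simp add: choi_L2_def mat_of_rows_list_def)

lemma latin_square_choi_L1: "latin_square 9 choi_L1"
  by (rule latin_squareI[OF choi_carrier(1),
        unfolded all_less_9 inj_on_lessThan_iff_distinct upt_9])
    (simp_all add: choi_L1_def mat_of_rows_list_def)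

lemma latin_square_choi_L2: "latin_square 9 choi_L2"
  by (rule latin_squareI[OF choi_carrier(2),
        unfolded all_less_9 inj_on_lessThan_iff_distinct upt_9])
    (simp_all add: choi_L2_def mat_of_rows_list_def)

lemma orthogonal_choi_L1: "orthogonal 9 choi_L1 (s0 choi_L1)"
  unfolding orthogonal_iff_distinct upt_9
  \<comment> \<open>Entries of \<open>s0 choi_L1\<close> become entries of \<open>choi_L1\<close>,
    then numerals. Without \<open>distinct.simps\<close> the simplifier leaves the 81 pairs
    uncompared, and \<open>code_simp\<close> evaluates their distinctness at the end.\<close>
  by (simp add: dihedral_index[OF choi_carrier(1)] del: distinct.simps,
      simp add: choi_L1_def mat_of_rows_list_def del: distinct.simps, code_simp)

lemma orthogonal_choi_L2: "orthogonal 9 choi_L2 (s0 choi_L2)"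
  unfolding orthogonal_iff_distinct upt_9
  by (simp add: dihedral_index[OF choi_carrier(2)] del: distinct.simps,
      simp add: choi_L2_def mat_of_rows_list_def del: distinct.simps, code_simp)

theorem corollary3p6:
  fixes L :: "nat mat"
  assumes "L = choi_L1 \<or> L = choi_L2"
  shows "max_mutually_orthogonal 9 (D8 L) = 2"
  using assms
proof
  assume "L = choi_L1"
  then show ?thesis
    using max_mutually_orthogonal_D8_eq_2[OF latin_square_choi_L1 _ _ orthogonal_choi_L1]
    by (simp add: s3_choi_L1)
next
  assume "L = choi_L2"
  then show ?thesis
    using max_mutually_orthogonal_D8_eq_2[OF latin_square_choi_L2 _ _ orthogonal_choi_L2]
    by (simp add: s1_choi_L2)
qed

end
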